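(* Fix $\alpha\in(0,1)$, $n\geq1$, and $d\geq1$. Let $\hat{L}_\alpha(\mathcal{F}_{\mathrm{lin}}^{(d)},\cdot)$ be a valid distribution-free lower bound on the model class risk of $\mathcal{F}_{\mathrm{lin}}^{(d)}$ (based on a sample of size $n$). Then for any distribution $P$ on $\mathbb{R}^d\times\mathbb{R}$, $$\mathbb{P}_P\left\{\hat{L}_\alpha(\mathcal{F}_{\mathrm{lin}}^{(d)},\mathcal{D}_n)>0\right\}\leq\alpha+\lambda_{n,d}(P).$$
   Context: Data points are $(X_i,Y_i)\in\mathbb{R}^d\times\mathbb{R}$ and $\mathcal{D}_n=((X_1,Y_1),\dots,(X_n,Y_n))$. The loss is the squared loss $\ell(f,(x,y))=(f(x)-y)^2$; $R_P(f)=\mathbb{E}_P[(f(X)-Y)^2]$ and $R_P(\mathcal{F})=\inf_{f\in\mathcal{F}}R_P(f)$. The class of linear predictors is $\mathcal{F}_{\mathrm{lin}}^{(d)}=\{x\mapsto x^\top\beta:\beta\in\mathbb{R}^d\}$. A (measurable) map $\hat{L}_\alpha(\mathcal{F},\cdot):(\mathbb{R}^d\times\mathbb{R})^n\to[0,\infty]$ is a valid distribution-free lower bound on the model class risk of $\mathcal{F}$ if $\mathbb{P}_P\{R_P(\mathcal{F})\geq\hat{L}_\alpha(\mathcal{F},\mathcal{D}_n)\}\geq1-\alpha$ for all distributions $P$ on $\mathbb{R}^d\times\mathbb{R}$, where $\mathbb{P}_P$ is with respect to $\mathcal{D}_n\sim P^n$. The bound may also be randomized: it may depend on an independent seed $\xi\sim\mathrm{Unif}[0,1]$,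 in which case all probabilities are also over $\xi$. Let $\mathcal{Q}_{\mathrm{lin}}$ be the set of distributions $P$ on $\mathbb{R}^d\times\mathbb{R}$ such that for some $\beta\in\mathbb{R}^d$, $Y=X^\top\beta$ holds $P$-almost surely; let $\mathcal{Q}_{\mathrm{lin}}^{(n)}=\{P^n:P\in\mathcal{Q}_{\mathrm{lin}}\}$; and let $\tilde{\mathcal{Q}}_{\mathrm{lin}}^{(n)}$ be the family of mixtures of distributions in $\mathcal{Q}_{\mathrm{lin}}^{(n)}$, i.e. distributions obtained by drawing $P_0\sim\nu$ for some probability measure $\nu$ on $\mathcal{Q}_{\mathrm{lin}}$ and then sampling from $(P_0)^n$. For a distribution $P$ on $\mathbb{R}^d\times\mathbb{R}$ define $\lambda_{n,d}(P)=\inf_{Q\in\tilde{\mathcal{Q}}_{\mathrm{lin}}^{(n)}}\mathrm{d}_{\mathrm{TV}}(P^n,Q)$, where $\mathrm{d}_{\mathrm{TV}}(\mu,\nu)=\sup_A|\mu(A)-\nu(A)|$ is total variation distance. *)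

theory Defs
  imports "HOL-Probability.Probability"
begin

text \<open>Distributions on \<open>\<real>\<^sup>d \<times> \<real>\<close> are the elements of \<^term>\<open>space (prob_algebra borel)\<close>, i.e. the
  probability measures on the Borel sets; the dimension is the cardinality of the index type.\<close>

type_synonym 'd obs = "(real ^ 'd) \<times> real"

text \<open>The product measure \<open>P\<^sup>n\<close>; a sample of size \<open>n\<close> is an extensional function on \<^term>\<open>{..<n}\<close>.\<close>

definition sample_law :: "nat \<Rightarrow> 'd::finite obs measure \<Rightarrow> (nat \<Rightarrow> 'd obs) measure" where
  "sample_law n P = (\<Pi>\<^sub>M i\<in>{..<n}. P)"

definition seed_law :: "real measure" where
  "seed_law = uniform_measure lborel {0..1}"

definition risk :: "'d::finite obs measure \<Rightarrow> (real ^ 'd \<Rightarrow> real) \<Rightarrow> ennreal" where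
  "risk P f = (\<integral>\<^sup>+(x, y). ennreal ((f x - y)\<^sup>2) \<partial>P)"

definition class_risk :: "'d::finite obs measure \<Rightarrow> (real ^ 'd \<Rightarrow> real) set \<Rightarrow> ennreal" where
  "class_risk P F = (INF f\<in>F. risk P f)"

definition linear_class :: "(real ^ 'd::finite \<Rightarrow> real) set" where
  "linear_class = {\<lambda>x. x \<bullet> \<beta> |\<beta>. True}"

text \<open>A randomized bound takes the sample and the seed. A bound that does not use the seed is one
  that is constant in its second argument; see \<open>valid_lower_bound_nonrandomized\<close> below.\<close>

definition valid_lower_bound ::
    "real \<Rightarrow> nat \<Rightarrow> (real ^ 'd::finite \<Rightarrow> real) set \<Rightarrow> ((nat \<Rightarrow> 'd obs) \<Rightarrow> real \<Rightarrow> ennreal) \<Rightarrow> bool" where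
  "valid_lower_bound \<alpha> n F L \<longleftrightarrow>
     (\<lambda>(D, \<xi>). L D \<xi>) \<in> borel_measurable ((\<Pi>\<^sub>M i\<in>{..<n}. borel) \<Otimes>\<^sub>M borel) \<and>
     (\<forall>P \<in> space (prob_algebra borel).
        \<P>((D, \<xi>) in sample_law n P \<Otimes>\<^sub>M seed_law. class_risk P F \<ge> L D \<xi>) \<ge> 1 - \<alpha>)"

definition Q_lin :: "'d::finite obs measure set" where
  "Q_lin = {P \<in> space (prob_algebra borel). \<exists>\<beta>. AE (x, y) in P. y = x \<bullet> \<beta>}"

text \<open>The mixing measure lives on \<^term>\<open>Q_lin\<close> with the trace of the \<open>\<sigma>\<close>-algebra generated by the
  evaluations \<open>P \<mapsto> P(A)\<close>. This is the coarsest choice for which the mixture makes sense, and a mixing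
  measure on a finer \<open>\<sigma>\<close>-algebra yields the same mixture as its restriction to this one.\<close>

definition Q_lin_mixtures :: "nat \<Rightarrow> (nat \<Rightarrow> 'd::finite obs) measure set" where
  "Q_lin_mixtures n =
     {bind \<nu> (sample_law n) |\<nu>. \<nu> \<in> space (prob_algebra (restrict_space (prob_algebra borel) Q_lin))}"

definition tv_dist :: "'a measure \<Rightarrow> 'a measure \<Rightarrow> real" where
  "tv_dist M N = (SUP A\<in>sets M. \<bar>measure M A - measure N A\<bar>)"

definition lambda_lin :: "nat \<Rightarrow> 'd::finite obs measure \<Rightarrow> real" where
  "lambda_lin n P = (INF Q\<in>Q_lin_mixtures n. tv_dist (sample_law n P) Q)"


lemma prob_space_seed_law: "prob_space seed_law"
  unfolding seed_law_def by (rule prob_space_uniform_measure) auto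

lemma prob_space_sample_law:
  "P \<in> space (prob_algebra borel) \<Longrightarrow> prob_space (sample_law n P)"
  unfolding sample_law_def by (intro prob_space_PiM) (auto simp: space_prob_algebra)

lemma sets_sample_law:
  "P \<in> space (prob_algebra borel) \<Longrightarrow> sets (sample_law n P) = sets (\<Pi>\<^sub>M i\<in>{..<n}. borel)"
  unfolding sample_law_def by (intro sets_PiM_cong) (auto simp: space_prob_algebra)

lemma measurable_sample_law:
  "sample_law n \<in> prob_algebra borel \<rightarrow>\<^sub>M prob_algebra (\<Pi>\<^sub>M i\<in>{..<n}. (borel :: 'd::finite obs measure))"
proof (rule measurable_prob_algebra_generated[OF sets_PiM Int_stable_prod_algebra prod_algebra_sets_into_space])
  fix A :: "(nat \<Rightarrow> 'd obs) set"
  assume "A \<in> prod_algebra {..<n} (\<lambda>_. borel)"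
  then obtain E where A: "A = (\<Pi>\<^sub>E i\<in>{..<n}. E i)" and E: "\<And>i. i < n \<Longrightarrow> E i \<in> sets borel"
    by (auto simp: prod_algebra_eq_finite)
  have "emeasure (sample_law n P) A = (\<Prod>i<n. emeasure P (E i))"
    if P: "P \<in> space (prob_algebra borel)" for P
  proof -
    interpret P: prob_space P using P by (simp add: space_prob_algebra)
    interpret finite_product_sigma_finite "\<lambda>_. P" "{..<n}" by unfold_locales auto
    show ?thesis
      unfolding A sample_law_def using P E by (subst measure_times) (auto simp: space_prob_algebra)
  qed
  moreover have "(\<lambda>P. \<Prod>i<n. emeasure P (E i)) \<in> borel_measurable (prob_algebra borel)"
    using E unfolding prob_algebra_def
    by (intro borel_measurable_prod measurable_restrict_space1 measurable_emeasure_subprob_algebra) auto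
  ultimately show "(\<lambda>P. emeasure (sample_law n P) A) \<in> borel_measurable (prob_algebra borel)"
    by (simp cong: measurable_cong)
qed (simp_all add: prob_space_sample_law sets_sample_law)

lemma emeasure_mixture:
  assumes "\<nu> \<in> space (prob_algebra (restrict_space (prob_algebra borel) Q_lin))"
    and "A \<in> sets (\<Pi>\<^sub>M i\<in>{..<n}. borel)"
  shows "emeasure (bind \<nu> (sample_law n)) A = (\<integral>\<^sup>+P. emeasure (sample_law n P) A \<partial>\<nu>)"
proof (rule emeasure_bind)
  have "sets \<nu> = sets (restrict_space (prob_algebra borel) Q_lin)" "prob_space \<nu>"
    using assms(1) by (auto simp: space_prob_algebra)
  then show "space \<nu> \<noteq> {}"
    "sample_law n \<in> \<nu> \<rightarrow>\<^sub>M subprob_algebra (\<Pi>\<^sub>M i\<in>{..<n}. borel)"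
    by (simp_all add: prob_space.not_empty measurable_restrict_space1 measurable_prob_algebraD
        measurable_sample_law cong: measurable_cong_sets)
qed (fact assms(2))

lemma valid_lower_bound_nonrandomized:
  fixes F :: "(real ^ 'd::finite \<Rightarrow> real) set"
  shows "valid_lower_bound \<alpha> n F (\<lambda>D \<xi>. L D) \<longleftrightarrow>
     L \<in> borel_measurable (\<Pi>\<^sub>M i\<in>{..<n}. borel) \<and>
     (\<forall>P \<in> space (prob_algebra borel). \<P>(D in sample_law n P. class_risk P F \<ge> L D) \<ge> 1 - \<alpha>)"
proof -
  have meas: "(\<lambda>(D, \<xi>). L D) \<in> borel_measurable ((\<Pi>\<^sub>M i\<in>{..<n}. borel) \<Otimes>\<^sub>M (borel :: real measure))
      \<longleftrightarrow> L \<in> borel_measurable (\<Pi>\<^sub>M i\<in>{..<n}. (borel :: 'd obs measure))" (is "?l \<longleftrightarrow> ?r")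
  proof
    assume ?l
    from measurable_compose[OF measurable_Pair2'[of 0] this] show ?r by simp
  qed (simp add: case_prod_beta')
  have "\<P>((D, \<xi>) in sample_law n P \<Otimes>\<^sub>M seed_law. class_risk P F \<ge> L D) =
      \<P>(D in sample_law n P. class_risk P F \<ge> L D)"
    if P: "P \<in> space (prob_algebra borel)" and L: ?r for P
  proof -
    interpret S: prob_space seed_law by (rule prob_space_seed_law)
    interpret D: prob_space "sample_law n P" by (rule prob_space_sample_law[OF P])
    interpret pair_prob_space "sample_law n P" seed_law ..
    let ?A = "{D \<in> space (sample_law n P). class_risk P F \<ge> L D}"
    have L': "L \<in> borel_measurable (sample_law n P)"
      using L by (simp add: sets_sample_law[OF P] cong: measurable_cong_sets)
    then have A: "?A \<in> sets (sample_law n P)" by measurable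
    have "{(D, \<xi>). (D, \<xi>) \<in> space (sample_law n P \<Otimes>\<^sub>M seed_law) \<and> class_risk P F \<ge> L D}
        = ?A \<times> space seed_law" (is "?B = _")
      by (auto simp: space_pair_measure)
    then have "emeasure (sample_law n P \<Otimes>\<^sub>M seed_law) ?B = emeasure (sample_law n P) ?A"
      using A by (simp only: S.emeasure_pair_measure_Times sets.top S.emeasure_space_1 mult_1_right)
    then show ?thesis
      unfolding measure_def by (simp only:)
  qed
  then show ?thesis
    unfolding valid_lower_bound_def meas by auto
qed

end

theory Submission
  imports Defs
begin

text \<open>
  If \<open>P\<^sub>0\<close> is in \<^const>\<open>Q_lin\<close>, some linear predictor has no error under \<open>P\<^sub>0\<close>, so the class risk
  is zero and validity of the bound says that it is positive with probability at most \<open>\<alpha>\<close>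
  (\<open>prob_bound_positive_le_if_Q_lin\<close>). Probabilities of a fixed event are affine in the law of the
  sample, so the same holds when the sample is drawn from a mixture \<open>Q\<close> of laws \<open>P\<^sub>0\<^sup>n\<close>
  (\<open>prob_bound_positive_le_if_mixture\<close>). Replacing \<open>Q\<close> by \<open>P\<^sup>n\<close> changes the probability by at most
  their total variation distance, also when the event involves an independent seed
  (\<open>measure_pair_le_tv_dist\<close>). The infimum over \<open>Q\<close> is the claim.
\<close>

lemma abs_measure_diff_le_tv_dist:
  assumes "prob_space M" "prob_space N" "A \<in> sets M"
  shows "\<bar>measure M A - measure N A\<bar> \<le> tv_dist M N"
  unfolding tv_dist_def
proof (rule cSUP_upper[OF assms(3)], rule bdd_aboveI2)
  fix B
  have "measure M B \<le> 1" "measure N B \<le> 1"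
    using assms(1,2) by (simp_all add: prob_space.prob_le_1)
  then show "\<bar>measure M B - measure N B\<bar> \<le> 1"
    using measure_nonneg[of M B] measure_nonneg[of N B] by linarith
qed

text \<open>Conditionally on the independent component, the event is an event about the first component
  alone, and there the definition of total variation applies. Fubini averages the resulting
  inequality over the independent component.\<close>

lemma measure_pair_le_tv_dist:
  assumes M: "prob_space M" and N: "prob_space N" and K: "prob_space K"
    and sets_eq: "sets N = sets M" and A: "A \<in> sets (M \<Otimes>\<^sub>M K)"
  shows "measure (M \<Otimes>\<^sub>M K) A \<le> measure (N \<Otimes>\<^sub>M K) A + tv_dist M N"
proof -
  interpret M: prob_space M by (rule M)
  interpret N: prob_space N by (rule N)
  interpret K: prob_space K by (rule K)
  interpret MK: pair_prob_space M K ..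
  interpret NK: pair_prob_space N K ..
  let ?slice = "\<lambda>y. (\<lambda>x. (x, y)) -` A"
  have A': "A \<in> sets (N \<Otimes>\<^sub>M K)"
    using A sets_eq by (simp cong: sets_pair_measure_cong)
  have tv_nonneg: "0 \<le> tv_dist M N"
    using abs_measure_diff_le_tv_dist[OF M N sets.empty_sets] by simp
  have slice_le: "emeasure M (?slice y) \<le> emeasure N (?slice y) + ennreal (tv_dist M N)" for y
  proof -
    have "?slice y \<in> sets M"
      using A by (rule sets_Pair2)
    from abs_measure_diff_le_tv_dist[OF M N this]
    have "measure M (?slice y) \<le> measure N (?slice y) + tv_dist M N"
      by linarith
    then show ?thesis
      using tv_nonneg
      by (simp add: M.emeasure_eq_measure N.emeasure_eq_measure flip: ennreal_plus)
  qed
  have "emeasure (M \<Otimes>\<^sub>M K) A = (\<integral>\<^sup>+y. emeasure M (?slice y) \<partial>K)"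
    by (rule MK.emeasure_pair_measure_alt2[OF A])
  also have "\<dots> \<le> (\<integral>\<^sup>+y. emeasure N (?slice y) + ennreal (tv_dist M N) \<partial>K)"
    by (rule nn_integral_mono) (rule slice_le)
  also have "\<dots> = (\<integral>\<^sup>+y. emeasure N (?slice y) \<partial>K) + ennreal (tv_dist M N)"
    by (subst nn_integral_add) (auto intro: NK.measurable_emeasure_Pair2 A' simp: K.emeasure_space_1)
  also have "(\<integral>\<^sup>+y. emeasure N (?slice y) \<partial>K) = emeasure (N \<Otimes>\<^sub>M K) A"
    by (rule NK.emeasure_pair_measure_alt2[OF A', symmetric])
  finally show ?thesis
    using tv_nonneg by (simp add: MK.emeasure_eq_measure NK.emeasure_eq_measure flip: ennreal_plus)
qed

text \<open>An independent component may be attached before or after mixing: the probability of an event of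
  the pair is the integral of the measures of its slices, which is linear in the law of the first
  component.\<close>

lemma emeasure_bind_pair:
  assumes "space \<nu> \<noteq> {}" and S: "S \<in> \<nu> \<rightarrow>\<^sub>M subprob_algebra N" and K: "sigma_finite_measure K"
    and A: "A \<in> sets (N \<Otimes>\<^sub>M K)"
  shows "emeasure (bind \<nu> S \<Otimes>\<^sub>M K) A = (\<integral>\<^sup>+x. emeasure (S x \<Otimes>\<^sub>M K) A \<partial>\<nu>)"
proof -
  interpret K: sigma_finite_measure K by (rule K)
  have pair: "emeasure (M \<Otimes>\<^sub>M K) A = (\<integral>\<^sup>+y. emeasure K (Pair y -` A) \<partial>M)"
    if "sets M = sets N" for M
    using A that by (intro K.emeasure_pair_measure_alt) (simp cong: sets_pair_measure_cong)
  have sets_bind: "sets (bind \<nu> S) = sets N"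
    using S assms(1) by (intro sets_bind) (auto dest: measurable_space simp: space_subprob_algebra)
  have "emeasure (bind \<nu> S \<Otimes>\<^sub>M K) A = (\<integral>\<^sup>+x. (\<integral>\<^sup>+y. emeasure K (Pair y -` A) \<partial>S x) \<partial>\<nu>)"
    unfolding pair[OF sets_bind]
    by (rule nn_integral_bind[OF K.measurable_emeasure_Pair[OF A] S])
  also have "\<dots> = (\<integral>\<^sup>+x. emeasure (S x \<Otimes>\<^sub>M K) A \<partial>\<nu>)"
    using S by (intro nn_integral_cong pair[symmetric])
      (auto dest: measurable_space simp: space_subprob_algebra)
  finally show ?thesis .
qed

lemma class_risk_linear_eq_0_if_Q_lin:
  assumes "P \<in> Q_lin"
  shows "class_risk P linear_class = 0"
proof -
  obtain \<beta> where "AE (x, y) in P. y = x \<bullet> \<beta>"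
    using assms unfolding Q_lin_def by auto
  then have "risk P (\<lambda>x. x \<bullet> \<beta>) = (\<integral>\<^sup>+z. 0 \<partial>P)"
    unfolding risk_def by (intro nn_integral_cong_AE) auto
  moreover have "(\<lambda>x. x \<bullet> \<beta>) \<in> linear_class"
    unfolding linear_class_def by auto
  ultimately show ?thesis
    unfolding class_risk_def by (metis INF_lower le_zero_eq nn_integral_const mult_zero_left)
qed

text \<open>The event is taken in the reference space of samples and seeds rather than in the space of one
  particular law, so that the same set can be measured under \<open>P\<^sub>0\<^sup>n\<close>, under a mixture and under
  \<open>P\<^sup>n\<close>, each paired with the seed.\<close>

definition bound_positive ::
    "nat \<Rightarrow> ((nat \<Rightarrow> 'd::finite obs) \<Rightarrow> real \<Rightarrow> ennreal) \<Rightarrow> ((nat \<Rightarrow> 'd obs) \<times> real) set" where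
  "bound_positive n L =
     {(D, \<xi>). (D, \<xi>) \<in> space ((\<Pi>\<^sub>M i\<in>{..<n}. borel) \<Otimes>\<^sub>M (borel :: real measure)) \<and> L D \<xi> > 0}"

lemma sets_seed_law: "sets seed_law = sets borel"
  unfolding seed_law_def by simp

lemma sets_pair_seed_law:
  assumes "sets M = sets N"
  shows "sets (M \<Otimes>\<^sub>M seed_law) = sets (N \<Otimes>\<^sub>M borel)"
  using assms by (intro sets_pair_measure_cong sets_seed_law)

lemma sets_bound_positive:
  assumes "valid_lower_bound \<alpha> n F L"
  shows "bound_positive n L \<in> sets ((\<Pi>\<^sub>M i\<in>{..<n}. borel) \<Otimes>\<^sub>M (borel :: real measure))"
proof -
  let ?N = "(\<Pi>\<^sub>M i\<in>{..<n}. borel) \<Otimes>\<^sub>M (borel :: real measure)"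
  have [measurable]: "(\<lambda>(D, \<xi>). L D \<xi>) \<in> borel_measurable ?N"
    using assms unfolding valid_lower_bound_def by auto
  have "{z \<in> space ?N. (case z of (D, \<xi>) \<Rightarrow> L D \<xi>) > 0} \<in> sets ?N"
    by measurable
  moreover have "bound_positive n L = {z \<in> space ?N. (case z of (D, \<xi>) \<Rightarrow> L D \<xi>) > 0}"
    unfolding bound_positive_def by auto
  ultimately show ?thesis by simp
qed

lemma prob_bound_positive_le_if_Q_lin:
  assumes valid: "valid_lower_bound \<alpha> n linear_class L" and P: "P \<in> Q_lin"
  shows "measure (sample_law n P \<Otimes>\<^sub>M seed_law) (bound_positive n L) \<le> \<alpha>"
proof -
  have P': "P \<in> space (prob_algebra borel)"
    using P by (simp add: Q_lin_def)
  interpret D: prob_space "sample_law n P" by (rule prob_space_sample_law[OF P'])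
  interpret S: prob_space seed_law by (rule prob_space_seed_law)
  interpret pair_prob_space "sample_law n P" seed_law ..
  let ?M = "sample_law n P \<Otimes>\<^sub>M seed_law"
  have sets_M: "sets ?M = sets ((\<Pi>\<^sub>M i\<in>{..<n}. borel) \<Otimes>\<^sub>M borel)"
    by (rule sets_pair_seed_law[OF sets_sample_law[OF P']])
  have event: "bound_positive n L \<in> sets ?M"
    using sets_bound_positive[OF valid] sets_M by simp
  have "{(D, \<xi>). (D, \<xi>) \<in> space ?M \<and> class_risk P linear_class \<ge> L D \<xi>} = space ?M - bound_positive n L"
    using sets_eq_imp_space_eq[OF sets_M]
    by (auto simp: bound_positive_def class_risk_linear_eq_0_if_Q_lin[OF P] not_gr_zero)
  moreover have "1 - \<alpha> \<le> \<P>((D, \<xi>) in ?M. class_risk P linear_class \<ge> L D \<xi>)"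
    using valid P' unfolding valid_lower_bound_def by blast
  ultimately have "1 - \<alpha> \<le> measure ?M (space ?M - bound_positive n L)"
    by (simp add: case_prod_beta')
  then show ?thesis
    by (simp add: prob_compl[OF event])
qed

context
  fixes \<nu> :: "'d::finite obs measure measure" and n :: nat
  assumes \<nu>: "\<nu> \<in> space (prob_algebra (restrict_space (prob_algebra borel) Q_lin))"
begin

lemma measurable_sample_law_mixing:
  "sample_law n \<in> \<nu> \<rightarrow>\<^sub>M prob_algebra (\<Pi>\<^sub>M i\<in>{..<n}. borel)"
  using \<nu> measurable_restrict_space1[OF measurable_sample_law]
  by (simp add: space_prob_algebra cong: measurable_cong_sets)

lemma space_mixing: "space \<nu> = Q_lin"
proof -
  have "space \<nu> = space (restrict_space (prob_algebra borel) Q_lin)"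
    using \<nu> by (intro sets_eq_imp_space_eq) (simp add: space_prob_algebra)
  then show ?thesis
    by (auto simp: space_restrict_space Q_lin_def)
qed

lemma prob_space_mixing: "prob_space \<nu>"
  using \<nu> by (simp add: space_prob_algebra)

lemma mixture_in_space_prob_algebra:
  "bind \<nu> (sample_law n) \<in> space (prob_algebra (\<Pi>\<^sub>M i\<in>{..<n}. borel))"
proof -
  have "\<nu> \<in> space (prob_algebra \<nu>)"
    by (simp add: space_prob_algebra prob_space_mixing)
  from prob_space_bind'[OF this measurable_sample_law_mixing] sets_bind'[OF this measurable_sample_law_mixing]
  show ?thesis
    by (simp add: space_prob_algebra)
qed

lemma prob_bound_positive_le_if_mixture:
  assumes valid: "valid_lower_bound \<alpha> n linear_class L" and "0 \<le> \<alpha>"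
  shows "measure (bind \<nu> (sample_law n) \<Otimes>\<^sub>M seed_law) (bound_positive n L) \<le> \<alpha>"
proof -
  interpret \<nu>: prob_space \<nu> by (rule prob_space_mixing)
  interpret S: prob_space seed_law by (rule prob_space_seed_law)
  let ?A = "bound_positive n L"
  have A: "?A \<in> sets ((\<Pi>\<^sub>M i\<in>{..<n}. borel) \<Otimes>\<^sub>M seed_law)"
    using sets_bound_positive[OF valid] by (simp add: sets_pair_seed_law)
  have le: "emeasure (sample_law n P \<Otimes>\<^sub>M seed_law) ?A \<le> ennreal \<alpha>" if "P \<in> space \<nu>" for P
  proof -
    have P: "P \<in> Q_lin"
      using that by (simp add: space_mixing)
    interpret D: prob_space "sample_law n P"
      using P by (intro prob_space_sample_law) (simp add: Q_lin_def)
    interpret pair_prob_space "sample_law n P" seed_law ..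
    show ?thesis
      using prob_bound_positive_le_if_Q_lin[OF valid P]
      by (simp add: emeasure_eq_measure ennreal_leI)
  qed
  have "emeasure (bind \<nu> (sample_law n) \<Otimes>\<^sub>M seed_law) ?A
      = (\<integral>\<^sup>+P. emeasure (sample_law n P \<Otimes>\<^sub>M seed_law) ?A \<partial>\<nu>)"
    using \<nu>.not_empty measurable_prob_algebraD[OF measurable_sample_law_mixing]
      S.sigma_finite_measure_axioms A
    by (rule emeasure_bind_pair)
  also have "\<dots> \<le> (\<integral>\<^sup>+P. ennreal \<alpha> \<partial>\<nu>)"
    by (rule nn_integral_mono) (rule le)
  also have "\<dots> = ennreal \<alpha>"
    by (simp add: \<nu>.emeasure_space_1)
  finally show ?thesis
    using \<open>0 \<le> \<alpha>\<close> unfolding measure_def by (intro enn2real_leI)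
qed

end

text \<open>The infimum of the empty set of reals is an unspecified number, so \<^const>\<open>lambda_lin\<close> carries
  information only because mixtures exist: take the point mass at the point mass at the origin.\<close>

lemma Q_lin_mixtures_nonempty: "Q_lin_mixtures n \<noteq> ({} :: (nat \<Rightarrow> 'd::finite obs) measure set)"
proof -
  let ?P = "return borel (0 :: 'd obs)"
  let ?R = "restrict_space (prob_algebra borel) (Q_lin :: 'd obs measure set)"
  have "?P \<in> space (prob_algebra borel)"
    by (simp add: space_prob_algebra prob_space_return)
  moreover have "AE (x, y) in ?P. y = x \<bullet> 0"
  proof -
    have [measurable]: "snd \<in> borel_measurable (borel :: 'd obs measure)"
      by (intro borel_measurable_continuous_onI continuous_intros)
    have "Measurable.pred (borel :: 'd obs measure) (\<lambda>z. snd z = 0)"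
      by measurable
    then show ?thesis
      by (simp add: AE_return case_prod_beta')
  qed
  ultimately have "?P \<in> Q_lin"
    unfolding Q_lin_def by blast
  then have "?P \<in> space ?R"
    by (auto simp: space_restrict_space Q_lin_def)
  then have "return ?R ?P \<in> space (prob_algebra ?R)"
    by (simp add: space_prob_algebra prob_space_return)
  then show ?thesis
    unfolding Q_lin_mixtures_def by blast
qed

theorem theorem7:
  fixes \<alpha> :: real and n :: nat
    and L :: "(nat \<Rightarrow> 'd::finite obs) \<Rightarrow> real \<Rightarrow> ennreal"
    and P :: "'d obs measure"
  assumes "0 < \<alpha>" and "\<alpha> < 1" and "1 \<le> n"
    and "valid_lower_bound \<alpha> n linear_class L"
    and "P \<in> space (prob_algebra borel)"
  shows "\<P>((D, \<xi>) in sample_law n P \<Otimes>\<^sub>M seed_law. L D \<xi> > 0) \<le> \<alpha> + lambda_lin n P"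
proof -
  note valid = assms(4) and P = assms(5)
  let ?A = "bound_positive n L"
  have sets_P: "sets (sample_law n P \<Otimes>\<^sub>M seed_law) = sets ((\<Pi>\<^sub>M i\<in>{..<n}. borel) \<Otimes>\<^sub>M borel)"
    by (rule sets_pair_seed_law[OF sets_sample_law[OF P]])
  have A: "?A \<in> sets (sample_law n P \<Otimes>\<^sub>M seed_law)"
    using sets_bound_positive[OF valid] sets_P by simp
  have "measure (sample_law n P \<Otimes>\<^sub>M seed_law) ?A - \<alpha> \<le> tv_dist (sample_law n P) Q"
    if mixture: "Q \<in> Q_lin_mixtures n" for Q
  proof -
    obtain \<nu> where \<nu>: "\<nu> \<in> space (prob_algebra (restrict_space (prob_algebra borel) Q_lin))"
      and Q: "Q = bind \<nu> (sample_law n)"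
      using mixture unfolding Q_lin_mixtures_def by blast
    have "prob_space Q" "sets Q = sets (sample_law n P)"
      using mixture_in_space_prob_algebra[OF \<nu>, of n] sets_sample_law[OF P, of n]
      by (simp_all add: Q space_prob_algebra)
    then have "measure (sample_law n P \<Otimes>\<^sub>M seed_law) ?A
        \<le> measure (Q \<Otimes>\<^sub>M seed_law) ?A + tv_dist (sample_law n P) Q"
      by (intro measure_pair_le_tv_dist prob_space_sample_law P prob_space_seed_law A)
    then show ?thesis
      using prob_bound_positive_le_if_mixture[OF \<nu> valid] \<open>0 < \<alpha>\<close> by (simp add: Q)
  qed
  then have "measure (sample_law n P \<Otimes>\<^sub>M seed_law) ?A - \<alpha> \<le> lambda_lin n P"
    unfolding lambda_lin_def by (intro cINF_greatest Q_lin_mixtures_nonempty)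
  moreover have "{(D, \<xi>). (D, \<xi>) \<in> space (sample_law n P \<Otimes>\<^sub>M seed_law) \<and> L D \<xi> > 0} = ?A"
    using sets_eq_imp_space_eq[OF sets_P] by (auto simp: bound_positive_def)
  ultimately show ?thesis
    by (simp add: case_prod_beta')
qed

end
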